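(* Let $G_1,\ldots,G_n$ be nondeterministic automata, where $G_i$ has set of secret states $Q_i^S$, and consider the composed system $G_1\|\cdots\|G_n$ with interaction $\|_\lor$, i.e. with set of secret states $Q^S=Q\setminus(Q_1^{NS}\times\cdots\times Q_n^{NS})$, $Q_i^{NS}=Q_i\setminus Q_i^S$. For $1\le i\le n$ let $H_i=\Delta(det(G_i))\|\Delta_R(det(G_{i,R}))$ be the two-way observer of $G_i$. If every state reachable in $H_1\|\cdots\|H_n$, i.e. every $((X^1,X^1_R),\ldots,(X^n,X^n_R))$ with $H_1\|\cdots\|H_n\stackrel{s}{\to}((X^1,X^1_R),\ldots,(X^n,X^n_R))$ for some $s$, satisfies, for all $1\le i\le n$, $(X^i\cap X^i_R)\not\subseteq Q_i^S$ or $X^i\cap X^i_R=\emptyset$, then $G_1\|\cdots\|G_n$ is infinite-step opaque.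
   Context: An automaton is $G=\langle\Sigma_\tau,Q,\to,Q^\circ\rangle$ with finite set $\Sigma$ of observable events, a special unobservable event $\tau\notin\Sigma$, $\Sigma_\tau=\Sigma\cup\{\tau\}$, finite states $Q$, transitions $\to\subseteq Q\times\Sigma_\tau\times Q$, initial states $Q^\circ$, and secret states $Q^S\subseteq Q$, $Q^{NS}=Q\setminus Q^S$. For $s\in\Sigma^*$, $p\stackrel{s}{\Rightarrow}q$ means there is $t\in\Sigma_\tau^*$ which becomes $s$ after deleting all $\tau$'s and $p\stackrel{t}{\to}q$; $p\stackrel{s}{\Rightarrow}$ means this for some $q$; $L(G,q)=\{s:q\stackrel{s}{\Rightarrow}\}$. Synchronous composition: states are tuples, initial states products of initial states; a shared event (other than $\tau$, never shared) is executed jointly by all components having it in their alphabet; other events are executed by a single component while the others stay put. Infinite-step opacity: $G$ is infinite-step opaque w.r.t. $Q^S$ iff for every $q^\circ\in Q^\circ$ and all $s,t\in\Sigma^*$ with $st\in L(G,q^\circ)$ and $q^\circ\stackrel{s}{\Rightarrow}Q^S$, there exist $q'^\circ\in Q^\circ$ and $y\in Q^{NS}$ with $q'^\circ\stackrel{s}{\Rightarrow}y$ and $y\stackrel{t}{\Rightarrow}$. Reversed automaton: $G_R=\langle\Sigma_\tau,Q,\to_R,Q\rangle$ with $(x,\sigma,y)\in\to_R$ iff $y\stackrel{\sigma}{\to}x$, all states initial. Current-state estimator: $UR(B)$ is the set of states reachable from $B$ by strings in $\{\tau\}^*$; $det(G)$ is the deterministic automaton over $\Sigma$ with initial state $UR(Q^\circ)$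 and transitions $X\stackrel{\sigma}{\to}Y$ where $Y=\bigcup\{UR(\{y\}): x\stackrel{\sigma}{\to}y, x\in X\}$ is nonempty; only reachable states are kept. Renamings $\Delta(\sigma)=(\sigma,\epsilon)$, $\Delta_R(\sigma)=(\epsilon,\sigma)$ relabel transitions; the two-way observer $H_i=\Delta(det(G_i))\|\Delta_R(det(G_{i,R}))$ has event set $\Delta(\Sigma_i)\cup\Delta_R(\Sigma_i)$ and states $(X^i,X^i_R)$ with $X^i,X^i_R\subseteq Q_i$; $H_1\|\cdots\|H_n$ synchronizes on common renamed events. *)

theory Defs
  imports Main "HOL-Library.FuncSet"
begin

datatype 'e act = Tau | Obs 'e

record ('q, 'e) automaton =
  alphabet :: "'e set"
  states :: "'q set"
  transitions :: "('q \<times> 'e act \<times> 'q) set"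
  inits :: "'q set"

definition automaton :: "('q, 'e) automaton \<Rightarrow> bool" where
  "automaton G \<longleftrightarrow> finite (alphabet G) \<and> finite (states G) \<and>
     transitions G \<subseteq> states G \<times> insert Tau (Obs ` alphabet G) \<times> states G \<and>
     inits G \<subseteq> states G"

primrec run :: "('q, 'e) automaton \<Rightarrow> 'q \<Rightarrow> 'e act list \<Rightarrow> 'q \<Rightarrow> bool" where
  "run G p [] q \<longleftrightarrow> p = q"
| "run G p (a # t) q \<longleftrightarrow> (\<exists>r. (p, a, r) \<in> transitions G \<and> run G r t q)"

definition weak :: "('q, 'e) automaton \<Rightarrow> 'q \<Rightarrow> 'e list \<Rightarrow> 'q \<Rightarrow> bool" where
  "weak G p s q \<longleftrightarrow> (\<exists>t. filter (\<lambda>a. a \<noteq> Tau) t = map Obs s \<and> run G p t q)"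

definition lang :: "('q, 'e) automaton \<Rightarrow> 'q \<Rightarrow> 'e list set" where
  "lang G q = {s \<in> lists (alphabet G). \<exists>q'. weak G q s q'}"

definition reachable :: "('q, 'e) automaton \<Rightarrow> 'q set" where
  "reachable G = {q. \<exists>p\<in>inits G. \<exists>t. run G p t q}"

definition infinite_step_opaque :: "('q, 'e) automaton \<Rightarrow> 'q set \<Rightarrow> bool" where
  "infinite_step_opaque G QS \<longleftrightarrow>
     (\<forall>q0\<in>inits G. \<forall>s\<in>lists (alphabet G). \<forall>t\<in>lists (alphabet G).
        s @ t \<in> lang G q0 \<and> (\<exists>x\<in>QS. weak G q0 s x) \<longrightarrow>
        (\<exists>q0'\<in>inits G. \<exists>y\<in>states G - QS. weak G q0' s y \<and> (\<exists>z. weak G y t z)))"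

definition sync2 ::
  "('p, 'e) automaton \<Rightarrow> ('q, 'e) automaton \<Rightarrow> ('p \<times> 'q, 'e) automaton" where
  "sync2 A B = \<lparr>
     alphabet = alphabet A \<union> alphabet B,
     states = states A \<times> states B,
     transitions =
       {((p, q), Obs \<sigma>, (p', q')) | p q \<sigma> p' q'.
          \<sigma> \<in> alphabet A \<inter> alphabet B \<and>
          (p, Obs \<sigma>, p') \<in> transitions A \<and> (q, Obs \<sigma>, q') \<in> transitions B} \<union>
       {((p, q), a, (p', q)) | p q a p'.
          a \<notin> Obs ` alphabet B \<and> (p, a, p') \<in> transitions A \<and> q \<in> states B} \<union>
       {((p, q), a, (p, q')) | p q a q'.
          a \<notin> Obs ` alphabet A \<and> p \<in> states A \<and> (q, a, q') \<in> transitions B},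
     inits = inits A \<times> inits B\<rparr>"

text \<open>
  In the \<open>n\<close>-ary composition a tuple \<open>(q\<^sub>1, \<dots>, q\<^sub>n)\<close> is an extensional function on the
  index set \<open>{1..n}\<close>.
\<close>

definition sync :: "nat \<Rightarrow> (nat \<Rightarrow> ('q, 'e) automaton) \<Rightarrow> (nat \<Rightarrow> 'q, 'e) automaton" where
  "sync n G = \<lparr>
     alphabet = (\<Union>i\<in>{1..n}. alphabet (G i)),
     states = (\<Pi>\<^sub>E i\<in>{1..n}. states (G i)),
     transitions =
       {(p, Obs \<sigma>, q) | p \<sigma> q.
          p \<in> (\<Pi>\<^sub>E i\<in>{1..n}. states (G i)) \<and> q \<in> (\<Pi>\<^sub>E i\<in>{1..n}. states (G i)) \<and>
          \<sigma> \<in> (\<Union>i\<in>{1..n}. alphabet (G i)) \<and>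
          (\<forall>i\<in>{1..n}. if \<sigma> \<in> alphabet (G i) then (p i, Obs \<sigma>, q i) \<in> transitions (G i)
                       else q i = p i)} \<union>
       {(p, Tau, q) | p q.
          p \<in> (\<Pi>\<^sub>E i\<in>{1..n}. states (G i)) \<and> q \<in> (\<Pi>\<^sub>E i\<in>{1..n}. states (G i)) \<and>
          (\<exists>i\<in>{1..n}. (p i, Tau, q i) \<in> transitions (G i) \<and>
             (\<forall>j\<in>{1..n} - {i}. q j = p j))},
     inits = (\<Pi>\<^sub>E i\<in>{1..n}. inits (G i))\<rparr>"

definition reversed :: "('q, 'e) automaton \<Rightarrow> ('q, 'e) automaton" where
  "reversed G = \<lparr>
     alphabet = alphabet G,
     states = states G,
     transitions = {(x, a, y). (y, a, x) \<in> transitions G},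
     inits = states G\<rparr>"

definition UR :: "('q, 'e) automaton \<Rightarrow> 'q set \<Rightarrow> 'q set" where
  "UR G B = {q. \<exists>p\<in>B. \<exists>t\<in>lists {Tau}. run G p t q}"

definition subset_automaton :: "('q, 'e) automaton \<Rightarrow> ('q set, 'e) automaton" where
  "subset_automaton G = \<lparr>
     alphabet = alphabet G,
     states = Pow (states G),
     transitions =
       {(X, Obs \<sigma>, Y) | X \<sigma> Y.
          X \<subseteq> states G \<and> \<sigma> \<in> alphabet G \<and>
          Y = \<Union> {UR G {y} | x y. x \<in> X \<and> (x, Obs \<sigma>, y) \<in> transitions G} \<and> Y \<noteq> {}},
     inits = {UR G (inits G)}\<rparr>"

definition accessible_part :: "('q, 'e) automaton \<Rightarrow> ('q, 'e) automaton" where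
  "accessible_part G = \<lparr>
     alphabet = alphabet G,
     states = reachable G,
     transitions = {(p, a, q). (p, a, q) \<in> transitions G \<and> p \<in> reachable G \<and> q \<in> reachable G},
     inits = inits G\<rparr>"

definition det :: "('q, 'e) automaton \<Rightarrow> ('q set, 'e) automaton" where
  "det G = accessible_part (subset_automaton G)"

definition relabel :: "('e \<Rightarrow> 'f) \<Rightarrow> ('q, 'e) automaton \<Rightarrow> ('q, 'f) automaton" where
  "relabel f G = \<lparr>
     alphabet = f ` alphabet G,
     states = states G,
     transitions = {(p, map_act f a, q) | p a q. (p, a, q) \<in> transitions G},
     inits = inits G\<rparr>"

text \<open>
  Renamed events are pairs of strings: \<open>[\<sigma>]\<close> is the event \<open>\<sigma>\<close> and \<open>[]\<close> is \<open>\<epsilon>\<close>.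
\<close>

definition Delta :: "'e \<Rightarrow> 'e list \<times> 'e list" where
  "Delta \<sigma> = ([\<sigma>], [])"

definition Delta_R :: "'e \<Rightarrow> 'e list \<times> 'e list" where
  "Delta_R \<sigma> = ([], [\<sigma>])"

definition two_way_observer ::
  "('q, 'e) automaton \<Rightarrow> ('q set \<times> 'q set, 'e list \<times> 'e list) automaton" where
  "two_way_observer G = sync2 (relabel Delta (det G)) (relabel Delta_R (det (reversed G)))"

text \<open>
  Secret states of a composition in which a tuple is secret as soon as one of its
  components is.
\<close>

definition secret_or ::
  "nat \<Rightarrow> (nat \<Rightarrow> ('q, 'e) automaton) \<Rightarrow> (nat \<Rightarrow> 'q set) \<Rightarrow> (nat \<Rightarrow> 'q) set" where
  "secret_or n G S = states (sync n G) - (\<Pi>\<^sub>E i\<in>{1..n}. states (G i) - S i)"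

end

theory Submission
  imports Defs
begin

text \<open>
  Two facts make the argument work. First, weak runs of the composition over \<open>s\<close> are exactly the
  tuples of weak runs of the components over the projections of \<open>s\<close>. Secondly, after
  \<open>s\<close> the estimator of \<open>G\<close> is in the set of states reached by \<open>s\<close>, and after the reversal of
  \<open>t\<close> the estimator of the reversed automaton is in the set of states from which \<open>t\<close> can be
  executed. Hence if the composition executes \<open>st\<close>, its state in between witnesses that the
  composed observer reaches a tuple with \<open>X\<^sup>i \<inter> X\<^sup>i\<^sub>R \<noteq> {}\<close> for all \<open>i\<close>. The
  hypothesis then gives a nonsecret element of each of these intersections, and these elements
  together form the required state.
\<close>

section \<open>Weak runs\<close>

lemma run_append: "run G p (t @ u) r \<longleftrightarrow> (\<exists>q. run G p t q \<and> run G q u r)"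
  by (induction t arbitrary: p) auto

lemma weak_Nil_refl [simp, intro]: "weak G p [] p"
  unfolding weak_def by (rule exI[of _ "[]"]) simp

text \<open>This cuts a run observed as a concatenation at the boundary of the two words. The cut
  comes right after the last event of the first word, so silent events at the boundary go to the
  second part.\<close>

lemma filter_eq_appendE:
  assumes "filter P xs = ys @ zs"
  obtains us vs where "xs = us @ vs" "filter P us = ys" "filter P vs = zs"
proof -
  have "\<exists>us vs. xs = us @ vs \<and> filter P us = ys \<and> filter P vs = zs"
    using assms
  proof (induction ys arbitrary: xs)
    case Nil
    then show ?case by (intro exI[of _ "[]"] exI[of _ xs]) simp
  next
    case (Cons y ys)
    then have "filter P xs = y # ys @ zs" by simp
    then obtain us ws where xs: "xs = us @ y # ws" "\<forall>u\<in>set us. \<not> P u" "P y"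
      and "filter P ws = ys @ zs"
      using filter_eq_ConsD by metis
    with Cons.IH obtain us' vs where "ws = us' @ vs" "filter P us' = ys" "filter P vs = zs"
      by blast
    with xs show ?case
      by (intro exI[of _ "us @ y # us'"] exI[of _ vs]) (simp add: filter_empty_conv)
  qed
  then show ?thesis using that by blast
qed

lemma weak_append: "weak G p (s @ t) r \<longleftrightarrow> (\<exists>q. weak G p s q \<and> weak G q t r)"
proof
  assume "weak G p (s @ t) r"
  then obtain u where u: "filter (\<lambda>a. a \<noteq> Tau) u = map Obs s @ map Obs t" "run G p u r"
    unfolding weak_def by auto
  then obtain v w where "u = v @ w" "filter (\<lambda>a. a \<noteq> Tau) v = map Obs s"
    "filter (\<lambda>a. a \<noteq> Tau) w = map Obs t"
    by (elim filter_eq_appendE)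
  with u(2) show "\<exists>q. weak G p s q \<and> weak G q t r"
    unfolding weak_def by (auto simp: run_append)
next
  assume "\<exists>q. weak G p s q \<and> weak G q t r"
  then obtain q v w where "filter (\<lambda>a. a \<noteq> Tau) v = map Obs s" "run G p v q"
    "filter (\<lambda>a. a \<noteq> Tau) w = map Obs t" "run G q w r"
    unfolding weak_def by blast
  then show "weak G p (s @ t) r"
    unfolding weak_def by (intro exI[of _ "v @ w"]) (auto simp: run_append)
qed

lemma weak_Nil_trans: "weak G p [] q \<Longrightarrow> weak G q s r \<Longrightarrow> weak G p s r"
  using weak_append[of G p "[]" s r] by auto

lemma weak_trans_Nil: "weak G p s q \<Longrightarrow> weak G q [] r \<Longrightarrow> weak G p s r"
  using weak_append[of G p s "[]" r] by auto

lemma weak_Tau_step: "(p, Tau, q) \<in> transitions G \<Longrightarrow> weak G p [] q"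
  unfolding weak_def by (rule exI[of _ "[Tau]"]) simp

lemma weak_Obs_step: "(p, Obs \<sigma>, q) \<in> transitions G \<Longrightarrow> weak G p [\<sigma>] q"
  unfolding weak_def by (rule exI[of _ "[Obs \<sigma>]"]) simp

text \<open>Isolates the one observable transition between a silent prefix and a silent suffix. Both
  the synchronization of components and the steps of the estimator act on this transition.\<close>

lemma weak_single_iff:
  "weak G p [\<sigma>] r \<longleftrightarrow>
     (\<exists>q q'. weak G p [] q \<and> (q, Obs \<sigma>, q') \<in> transitions G \<and> weak G q' [] r)"
proof
  assume "weak G p [\<sigma>] r"
  then obtain u where u: "filter (\<lambda>a. a \<noteq> Tau) u = [Obs \<sigma>]" "run G p u r"
    unfolding weak_def by auto
  then obtain v w where vw: "u = v @ Obs \<sigma> # w" "\<forall>a\<in>set v. \<not> a \<noteq> Tau"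
    "filter (\<lambda>a. a \<noteq> Tau) w = []"
    using filter_eq_ConsD[OF u(1)] by metis
  from u(2) vw(1) obtain q q' where "run G p v q" "(q, Obs \<sigma>, q') \<in> transitions G" "run G q' w r"
    by (auto simp: run_append)
  moreover have "filter (\<lambda>a. a \<noteq> Tau) v = []" using vw(2) by (simp add: filter_empty_conv)
  ultimately show "\<exists>q q'. weak G p [] q \<and> (q, Obs \<sigma>, q') \<in> transitions G \<and> weak G q' [] r"
    using vw(3) unfolding weak_def by fastforce
next
  assume "\<exists>q q'. weak G p [] q \<and> (q, Obs \<sigma>, q') \<in> transitions G \<and> weak G q' [] r"
  then show "weak G p [\<sigma>] r"
    by (blast intro: weak_Obs_step weak_Nil_trans weak_trans_Nil)
qed

section \<open>Closure of state sets under runs, and reversal of runs\<close>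

lemma reachable_step:
  "x \<in> reachable G \<Longrightarrow> (x, a, y) \<in> transitions G \<Longrightarrow> y \<in> reachable G"
proof -
  assume "x \<in> reachable G" "(x, a, y) \<in> transitions G"
  then have "\<exists>p\<in>inits G. \<exists>t. run G p (t @ [a]) y"
    unfolding reachable_def run_append by auto
  then show ?thesis unfolding reachable_def by blast
qed

lemma run_in_states:
  assumes "automaton G" "run G p t q" "p \<in> states G"
  shows "q \<in> states G"
  using assms(2,3)
proof (induction t arbitrary: p)
  case (Cons a t)
  then obtain r where "(p, a, r) \<in> transitions G" "run G r t q" by auto
  moreover from this(1) assms(1) have "r \<in> states G" unfolding automaton_def by auto
  ultimately show ?case using Cons.IH by blast
qed simp

lemma weak_in_states:
  "automaton G \<Longrightarrow> weak G p s q \<Longrightarrow> p \<in> states G \<Longrightarrow> q \<in> states G"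
  unfolding weak_def using run_in_states by metis

lemma run_reversed: "run (reversed G) p (rev t) q \<longleftrightarrow> run G q t p"
  by (induction t arbitrary: q) (auto simp: run_append reversed_def)

text \<open>Deleting silent events commutes with list reversal, so the reversal of runs carries over
  to observed words.\<close>

lemma weak_reversed: "weak (reversed G) p (rev s) q \<longleftrightarrow> weak G q s p"
proof
  assume "weak (reversed G) p (rev s) q"
  then obtain t where t: "filter (\<lambda>a. a \<noteq> Tau) t = rev (map Obs s)" "run (reversed G) p t q"
    unfolding weak_def rev_map by auto
  have "filter (\<lambda>a. a \<noteq> Tau) (rev t) = map Obs s"
    using t(1) by (simp flip: rev_filter)
  moreover have "run G q (rev t) p" using t(2) run_reversed[of G p "rev t" q] by simp
  ultimately show "weak G q s p" unfolding weak_def by blast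
next
  assume "weak G q s p"
  then obtain t where t: "filter (\<lambda>a. a \<noteq> Tau) t = map Obs s" "run G q t p"
    unfolding weak_def by auto
  have "filter (\<lambda>a. a \<noteq> Tau) (rev t) = map Obs (rev s)"
    using t(1) by (simp add: rev_map flip: rev_filter)
  moreover have "run (reversed G) p (rev t) q" using t(2) by (simp add: run_reversed)
  ultimately show "weak (reversed G) p (rev s) q" unfolding weak_def by blast
qed

lemma automaton_reversed: "automaton G \<Longrightarrow> automaton (reversed G)"
  unfolding automaton_def reversed_def by auto

section \<open>Weak runs of a synchronous composition\<close>

text \<open>The natural projection to a local alphabet: a component takes part in exactly the events
  that it knows.\<close>

abbreviation proj :: "('q, 'e) automaton \<Rightarrow> 'e list \<Rightarrow> 'e list" where
  "proj G \<equiv> filter (\<lambda>\<sigma>. \<sigma> \<in> alphabet G)"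

lemma sync_ObsI:
  assumes "p \<in> (\<Pi>\<^sub>E i\<in>{1..n}. states (G i))" "q \<in> (\<Pi>\<^sub>E i\<in>{1..n}. states (G i))"
    and "\<sigma> \<in> (\<Union>i\<in>{1..n}. alphabet (G i))"
    and "\<And>i. i \<in> {1..n} \<Longrightarrow>
      if \<sigma> \<in> alphabet (G i) then (p i, Obs \<sigma>, q i) \<in> transitions (G i) else q i = p i"
  shows "(p, Obs \<sigma>, q) \<in> transitions (sync n G)"
  using assms unfolding sync_def by auto

text \<open>A step of the composition that does not involve component \<open>i\<close> leaves its
  state unchanged, and the projection erases it. The induction follows the run and not
  \<open>s\<close>, since silent steps do not shorten \<open>s\<close>.\<close>

lemma run_sync_component:
  assumes "i \<in> {1..n}" "run (sync n G) p t q" "filter (\<lambda>a. a \<noteq> Tau) t = map Obs s"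
  shows "weak (G i) (p i) (proj (G i) s) (q i)"
  using assms(2,3)
proof (induction t arbitrary: p s)
  case (Cons a t)
  then obtain r where r: "(p, a, r) \<in> transitions (sync n G)" "run (sync n G) r t q" by auto
  show ?case
  proof (cases a)
    case Tau
    then have "weak (G i) (r i) (proj (G i) s) (q i)" using Cons r by simp
    moreover have "weak (G i) (p i) [] (r i)"
    proof -
      from r(1) Tau obtain j where "(p j, Tau, r j) \<in> transitions (G j)"
        "\<forall>k\<in>{1..n} - {j}. r k = p k"
        unfolding sync_def by auto
      then show ?thesis using assms(1) weak_Tau_step by (cases "j = i") auto
    qed
    ultimately show ?thesis using weak_Nil_trans by metis
  next
    case (Obs \<sigma>)
    then obtain s' where s': "s = \<sigma> # s'" "filter (\<lambda>a. a \<noteq> Tau) t = map Obs s'"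
      using Cons.prems(2) by auto
    then have IH: "weak (G i) (r i) (proj (G i) s') (q i)" using Cons.IH r by simp
    have step: "if \<sigma> \<in> alphabet (G i) then (p i, Obs \<sigma>, r i) \<in> transitions (G i) else r i = p i"
      using r(1) Obs assms(1) unfolding sync_def by auto
    show ?thesis
    proof (cases "\<sigma> \<in> alphabet (G i)")
      case True
      then have "weak (G i) (p i) [\<sigma>] (r i)" using step weak_Obs_step by simp
      then have "weak (G i) (p i) ([\<sigma>] @ proj (G i) s') (q i)"
        using IH unfolding weak_append by blast
      then show ?thesis using True s'(1) by simp
    next
      case False
      then show ?thesis using step IH s'(1) by simp
    qed
  qed
qed simp

lemma weak_sync_component:
  "i \<in> {1..n} \<Longrightarrow> weak (sync n G) p s q \<Longrightarrow> weak (G i) (p i) (proj (G i) s) (q i)"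
  using run_sync_component unfolding weak_def[of "sync n G"] by blast

section \<open>Assembling runs of the composition from runs of its components\<close>

lemma run_Tau_sync_upd:
  assumes "automaton (G i)" "i \<in> {1..n}"
    and "run (G i) (p i) t b" "filter (\<lambda>a. a \<noteq> Tau) t = []" "p \<in> states (sync n G)"
  shows "weak (sync n G) p [] (p(i := b))"
  using assms(3-5)
proof (induction t arbitrary: p)
  case (Cons a t)
  then obtain r where r: "(p i, Tau, r) \<in> transitions (G i)" "run (G i) r t b"
    by (auto split: if_splits)
  have "r \<in> states (G i)" using r(1) assms(1) unfolding automaton_def by auto
  then have st: "p(i := r) \<in> states (sync n G)"
    using Cons.prems(3) assms(2) unfolding sync_def by (auto simp: PiE_iff extensional_def)
  \<comment> \<open>Silent events are never shared, so component \<open>i\<close> can move while all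
    others stay put.\<close>
  then have "(p, Tau, p(i := r)) \<in> transitions (sync n G)"
    using Cons.prems(3) r(1) assms(2) unfolding sync_def by auto
  moreover have "weak (sync n G) (p(i := r)) [] ((p(i := r))(i := b))"
    by (rule Cons.IH) (use r(2) Cons.prems(2) st in \<open>simp_all del: fun_upd_apply add: fun_upd_same split: if_splits\<close>)
  ultimately show ?case using weak_Tau_step weak_Nil_trans by (metis fun_upd_upd)
qed (auto simp: fun_upd_idem)

lemma weak_Nil_sync:
  assumes aut: "\<And>i. i \<in> {1..n} \<Longrightarrow> automaton (G i)"
    and p: "p \<in> states (sync n G)" and q: "q \<in> states (sync n G)"
    and w: "\<And>i. i \<in> {1..n} \<Longrightarrow> weak (G i) (p i) [] (q i)"
  shows "weak (sync n G) p [] q"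
proof -
  \<comment> \<open>Silent moves of different components are independent and can be made one
    component after the other; \<open>J\<close> is the set of components that have already
    moved.\<close>
  have "weak (sync n G) p [] (override_on p q J)" if "finite J" "J \<subseteq> {1..n}" for J
    using that
  proof (induction J rule: finite_induct)
    case (insert i J)
    let ?p = "override_on p q J"
    have i: "i \<in> {1..n}" and J: "J \<subseteq> {1..n}" using insert.prems by auto
    have "?p \<in> states (sync n G)"
      using p q J unfolding sync_def by (auto simp: PiE_iff extensional_def override_on_def)
    moreover have "?p i = p i" using insert.hyps by simp
    ultimately have "weak (sync n G) ?p [] (?p(i := q i))"
      using w[OF i] run_Tau_sync_upd[of G i n ?p _ "q i"] aut i unfolding weak_def[of "G i"] by auto
    moreover have "?p(i := q i) = override_on p q (insert i J)"
      by (simp add: override_on_insert)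
    ultimately show ?case using insert.IH[OF J] weak_Nil_trans by metis
  qed simp
  from this[of "{1..n}"] have "weak (sync n G) p [] (override_on p q {1..n})" by simp
  moreover have "override_on p q {1..n} = q"
    using p q unfolding sync_def
    by (auto simp: override_on_def PiE_iff extensional_def fun_eq_iff)
  ultimately show ?thesis by simp
qed

text \<open>Converse of \<open>weak_sync_component\<close>. Each event of \<open>s\<close> is
  preceded by a round of silent moves in which every component gets ready for it; then all
  components that know the event execute it together.\<close>

lemma weak_sync:
  assumes aut: "\<And>i. i \<in> {1..n} \<Longrightarrow> automaton (G i)"
    and "s \<in> lists (alphabet (sync n G))"
    and "p \<in> states (sync n G)" and q: "q \<in> states (sync n G)"
    and "\<And>i. i \<in> {1..n} \<Longrightarrow> weak (G i) (p i) (proj (G i) s) (q i)"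
  shows "weak (sync n G) p s q"
  using assms(2,3,5)
proof (induction s arbitrary: p rule: list.induct)
  case Nil
  then show ?case using weak_Nil_sync[OF aut _ q] by simp
next
  case (Cons \<sigma> s)
  \<comment> \<open>Here \<open>a\<close> and \<open>b\<close> are the local states just before and
    just after \<open>\<sigma>\<close>. Silent moves after \<open>\<sigma>\<close> are left to the
    rest of the word. A component that does not know \<open>\<sigma>\<close> waits, with
    \<open>a\<close> and \<open>b\<close> both equal to \<open>p i\<close>.\<close>
  have "\<exists>a b. weak (G i) (p i) [] a \<and> weak (G i) b (proj (G i) s) (q i) \<and>
      (if \<sigma> \<in> alphabet (G i) then (a, Obs \<sigma>, b) \<in> transitions (G i) else b = a)"
    if i: "i \<in> {1..n}" for i
  proof (cases "\<sigma> \<in> alphabet (G i)")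
    case True
    then have "weak (G i) (p i) ([\<sigma>] @ proj (G i) s) (q i)" using Cons.prems(3)[OF i] by simp
    then show ?thesis
      unfolding weak_append weak_single_iff using True weak_Nil_trans by (metis (full_types))
  next
    case False
    then show ?thesis using Cons.prems(3)[OF i] by (intro exI[of _ "p i"]) simp
  qed
  then obtain a b where ab: "\<And>i. i \<in> {1..n} \<Longrightarrow> weak (G i) (p i) [] (a i)"
    "\<And>i. i \<in> {1..n} \<Longrightarrow> weak (G i) (b i) (proj (G i) s) (q i)"
    "\<And>i. i \<in> {1..n} \<Longrightarrow>
      if \<sigma> \<in> alphabet (G i) then (a i, Obs \<sigma>, b i) \<in> transitions (G i) else b i = a i"
    by metis
  let ?a = "restrict a {1..n}" and ?b = "restrict b {1..n}"
  have a_st: "a i \<in> states (G i)" if i: "i \<in> {1..n}" for i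
    using weak_in_states[OF aut[OF i] ab(1)[OF i]] Cons.prems(2) i
    unfolding sync_def by (auto simp: PiE_iff)
  have b_st: "b i \<in> states (G i)" if i: "i \<in> {1..n}" for i
    using ab(3)[OF i] a_st[OF i] aut[OF i] unfolding automaton_def by (auto split: if_splits)
  have st: "?a \<in> states (sync n G)" "?b \<in> states (sync n G)"
    using a_st b_st unfolding sync_def by auto
  have "weak (sync n G) p [] ?a"
    using weak_Nil_sync[OF aut Cons.prems(2) st(1)] ab(1) by simp
  moreover have "(?a, Obs \<sigma>, ?b) \<in> transitions (sync n G)"
    using st ab(3) Cons.prems(1) unfolding sync_def by auto
  ultimately have "weak (sync n G) p [\<sigma>] ?b"
    using weak_Obs_step weak_Nil_trans by metis
  moreover have "weak (sync n G) ?b s q"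
    by (rule Cons.IH[OF _ st(2)]) (use Cons.prems(1) ab(2) in simp_all)
  ultimately show ?case using weak_append[of "sync n G" p "[\<sigma>]" s q] by auto
qed

section \<open>State estimates\<close>

text \<open>Defined by weak runs instead of by iterating the subset construction; the lemmas below
  identify a nonempty estimate with a state of \<open>det G\<close>.\<close>

definition estimate :: "('q, 'e) automaton \<Rightarrow> 'e list \<Rightarrow> 'q set" where
  "estimate G s = {q. \<exists>p\<in>inits G. weak G p s q}"

lemma reversed_simps [simp]:
  "alphabet (reversed G) = alphabet G" "inits (reversed G) = states G"
  by (simp_all add: reversed_def)

text \<open>All states are initial in the reversed automaton, so reading a word backwards there
  yields the states from which the word can be executed, wherever it ends.\<close>

lemma estimate_reversed:
  "estimate (reversed G) (rev s) = {q. \<exists>p\<in>states G. weak G q s p}"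
  by (simp add: estimate_def weak_reversed)

lemma estimate_subset: "automaton G \<Longrightarrow> estimate G s \<subseteq> states G"
  unfolding estimate_def using weak_in_states by (fastforce simp: automaton_def)

section \<open>Estimates as states of the current-state estimator\<close>

lemma UR_eq: "UR G B = {q. \<exists>p\<in>B. weak G p [] q}"
proof -
  have "t \<in> lists {Tau} \<longleftrightarrow> filter (\<lambda>a. a \<noteq> Tau) t = []" for t :: "'b act list"
    by (auto simp: filter_empty_conv in_lists_conv_set)
  then show ?thesis unfolding UR_def weak_def by auto
qed

lemma estimate_Nil: "estimate G [] = UR G (inits G)"
  by (simp add: estimate_def UR_eq)

text \<open>Silent moves before \<open>\<sigma>\<close> are absorbed by the estimate for
  \<open>s\<close>, those after it by \<open>UR\<close>. The right-hand side is the successor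
  formula of the subset construction.\<close>

lemma estimate_snoc:
  "estimate G (s @ [\<sigma>]) =
     \<Union> {UR G {y} | x y. x \<in> estimate G s \<and> (x, Obs \<sigma>, y) \<in> transitions G}" (is "?L = ?R")
proof
  show "?L \<subseteq> ?R"
  proof
    fix z assume "z \<in> ?L"
    then obtain p q x y where "p \<in> inits G" "weak G p s q" "weak G q [] x"
      "(x, Obs \<sigma>, y) \<in> transitions G" "weak G y [] z"
      unfolding estimate_def weak_append weak_single_iff by blast
    moreover from this(1) weak_trans_Nil[OF this(2,3)] have "x \<in> estimate G s"
      unfolding estimate_def by blast
    moreover have "z \<in> UR G {y}" using \<open>weak G y [] z\<close> by (simp add: UR_eq)
    ultimately show "z \<in> ?R" by blast
  qed
  show "?R \<subseteq> ?L"
  proof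
    fix z assume "z \<in> ?R"
    then obtain p x y where p: "p \<in> inits G" "weak G p s x"
      and "(x, Obs \<sigma>, y) \<in> transitions G" "weak G y [] z"
      by (auto simp: UR_eq estimate_def)
    then have "weak G x [\<sigma>] z" using weak_Obs_step weak_trans_Nil by metis
    with p show "z \<in> ?L" unfolding estimate_def weak_append by blast
  qed
qed

text \<open>The estimator has no transition into the empty set. By this lemma, nonemptiness at the
  end of a word gives it at every prefix, so the whole path exists.\<close>

lemma estimate_snoc_nonempty: "estimate G (s @ [\<sigma>]) \<noteq> {} \<Longrightarrow> estimate G s \<noteq> {}"
  unfolding estimate_snoc by blast

lemma estimate_step:
  assumes "automaton G" "\<sigma> \<in> alphabet G" "estimate G (s @ [\<sigma>]) \<noteq> {}"
  shows "(estimate G s, Obs \<sigma>, estimate G (s @ [\<sigma>])) \<in> transitions (subset_automaton G)"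
  using assms estimate_subset[OF assms(1), of s] unfolding subset_automaton_def
  by (simp add: estimate_snoc)

lemma estimate_reachable:
  assumes "automaton G" "s \<in> lists (alphabet G)" "estimate G s \<noteq> {}"
  shows "estimate G s \<in> reachable (subset_automaton G)"
  using assms(2,3)
proof (induction s rule: rev_induct)
  case Nil
  have "estimate G [] \<in> inits (subset_automaton G)"
    by (simp add: subset_automaton_def estimate_Nil)
  then show ?case unfolding reachable_def by (blast intro: run.simps(1)[THEN iffD2])
next
  case (snoc \<sigma> s)
  then have "estimate G s \<in> reachable (subset_automaton G)"
    using estimate_snoc_nonempty[of G s \<sigma>] by auto
  moreover have "(estimate G s, Obs \<sigma>, estimate G (s @ [\<sigma>])) \<in> transitions (subset_automaton G)"
    using estimate_step[OF assms(1)] snoc.prems by simp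
  ultimately show ?case by (rule reachable_step)
qed

lemma estimate_in_det:
  assumes "automaton G" "s \<in> lists (alphabet G)" "estimate G s \<noteq> {}"
  shows "estimate G s \<in> states (det G)"
  using estimate_reachable[OF assms] by (simp add: det_def accessible_part_def)

lemma estimate_step_det:
  assumes "automaton G" "s \<in> lists (alphabet G)" "\<sigma> \<in> alphabet G" "estimate G (s @ [\<sigma>]) \<noteq> {}"
  shows "(estimate G s, Obs \<sigma>, estimate G (s @ [\<sigma>])) \<in> transitions (det G)"
  using estimate_step[OF assms(1,3,4)] estimate_reachable[OF assms(1,2)]
    estimate_reachable[OF assms(1), of "s @ [\<sigma>]"] assms estimate_snoc_nonempty[of G s \<sigma>]
  by (simp add: det_def accessible_part_def)

lemma alphabet_det [simp]: "alphabet (det G) = alphabet G"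
  by (simp add: det_def accessible_part_def subset_automaton_def)

lemma inits_det: "inits (det G) = {estimate G []}"
  by (simp add: det_def accessible_part_def subset_automaton_def estimate_Nil)

section \<open>Composition of the two-way observers\<close>

text \<open>The two renamings have disjoint ranges, so the two factors of a two-way observer share
  no event and move independently.\<close>

lemma Delta_simps [simp]:
  "Delta \<sigma> = Delta \<sigma>' \<longleftrightarrow> \<sigma> = \<sigma>'" "Delta_R \<sigma> = Delta_R \<sigma>' \<longleftrightarrow> \<sigma> = \<sigma>'"
  "Delta \<sigma> \<noteq> Delta_R \<sigma>'" "Delta_R \<sigma> \<noteq> Delta \<sigma>'"
  by (auto simp: Delta_def Delta_R_def)

lemma alphabet_two_way_observer:
  "alphabet (two_way_observer G) = Delta ` alphabet G \<union> Delta_R ` alphabet G"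
  by (simp add: two_way_observer_def sync2_def relabel_def)

lemma relabel_Obs: "(p, Obs \<sigma>, q) \<in> transitions G \<Longrightarrow> (p, Obs (f \<sigma>), q) \<in> transitions (relabel f G)"
  unfolding relabel_def by force

definition observer_state :: "('q, 'e) automaton \<Rightarrow> 'e list \<Rightarrow> 'e list \<Rightarrow> 'q set \<times> 'q set" where
  "observer_state G s u = (estimate G s, estimate (reversed G) u)"

lemma observer_state_in_states:
  assumes "automaton G" "s \<in> lists (alphabet G)" "u \<in> lists (alphabet G)"
    and "estimate G s \<noteq> {}" "estimate (reversed G) u \<noteq> {}"
  shows "observer_state G s u \<in> states (two_way_observer G)"
  using assms estimate_in_det[of G s] estimate_in_det[of "reversed G" u] automaton_reversed[of G]
  by (simp add: observer_state_def two_way_observer_def sync2_def relabel_def)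

lemma observer_state_Nil: "observer_state G [] [] \<in> inits (two_way_observer G)"
  by (simp add: observer_state_def two_way_observer_def sync2_def relabel_def inits_det)

text \<open>The backward factor does not know \<open>Delta \<sigma>\<close> and stays put. Its
  estimate is assumed nonempty so that it is a state of the estimator at all.\<close>

lemma observer_state_Delta:
  assumes "automaton G" "s \<in> lists (alphabet G)" "u \<in> lists (alphabet G)" "\<sigma> \<in> alphabet G"
    and "estimate G (s @ [\<sigma>]) \<noteq> {}" "estimate (reversed G) u \<noteq> {}"
  shows "(observer_state G s u, Obs (Delta \<sigma>), observer_state G (s @ [\<sigma>]) u)
    \<in> transitions (two_way_observer G)"
  using relabel_Obs[OF estimate_step_det[OF assms(1,2,4,5)], of Delta]
    estimate_in_det[of "reversed G" u] automaton_reversed[OF assms(1)] assms(3,6)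
  by (auto simp: observer_state_def two_way_observer_def sync2_def relabel_def)

lemma observer_state_Delta_R:
  assumes "automaton G" "s \<in> lists (alphabet G)" "u \<in> lists (alphabet G)" "\<sigma> \<in> alphabet G"
    and "estimate G s \<noteq> {}" "estimate (reversed G) (u @ [\<sigma>]) \<noteq> {}"
  shows "(observer_state G s u, Obs (Delta_R \<sigma>), observer_state G s (u @ [\<sigma>]))
    \<in> transitions (two_way_observer G)"
  using relabel_Obs[OF estimate_step_det[of "reversed G" u \<sigma>], of Delta_R]
    estimate_in_det[OF assms(1,2,5)] automaton_reversed[OF assms(1)] assms(3,4,6)
  by (auto simp: observer_state_def two_way_observer_def sync2_def relabel_def)

section \<open>Reachable tuples of the composed observer\<close>

definition joint_state ::
  "nat \<Rightarrow> (nat \<Rightarrow> ('q, 'e) automaton) \<Rightarrow> 'e list \<Rightarrow> 'e list \<Rightarrow> nat \<Rightarrow> 'q set \<times> 'q set" where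
  "joint_state n G s u = (\<lambda>i\<in>{1..n}. observer_state (G i) (proj (G i) s) (proj (G i) u))"

text \<open>The condition under which no component blocks: all local estimators can follow their
  projections without running into the empty set.\<close>

definition consistent :: "nat \<Rightarrow> (nat \<Rightarrow> ('q, 'e) automaton) \<Rightarrow> 'e list \<Rightarrow> 'e list \<Rightarrow> bool" where
  "consistent n G s u \<longleftrightarrow> (\<forall>i\<in>{1..n}. estimate (G i) (proj (G i) s) \<noteq> {} \<and>
     estimate (reversed (G i)) (proj (G i) u) \<noteq> {})"

lemma consistent_snoc1: "consistent n G (s @ [\<sigma>]) u \<Longrightarrow> consistent n G s u"
  unfolding consistent_def using estimate_snoc_nonempty
  by (fastforce split: if_splits)

lemma consistent_snoc2: "consistent n G s (u @ [\<sigma>]) \<Longrightarrow> consistent n G s u"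
  unfolding consistent_def using estimate_snoc_nonempty
  by (fastforce split: if_splits)

lemma proj_in_lists: "proj G s \<in> lists (alphabet G)"
  by auto

lemma joint_state_in_states:
  assumes "\<And>i. i \<in> {1..n} \<Longrightarrow> automaton (G i)" "consistent n G s u"
  shows "joint_state n G s u \<in> (\<Pi>\<^sub>E i\<in>{1..n}. states (two_way_observer (G i)))"
  using assms observer_state_in_states[OF _ proj_in_lists proj_in_lists]
  unfolding joint_state_def consistent_def by (intro restrict_PiE_iff[THEN iffD2]) blast

text \<open>Components that know \<open>\<sigma>\<close> advance by
  \<open>observer_state_Delta\<close>; for the others the projection, and with it the local state,
  does not change.\<close>

lemma joint_state_Delta:
  assumes aut: "\<And>i. i \<in> {1..n} \<Longrightarrow> automaton (G i)"
    and \<sigma>: "\<sigma> \<in> alphabet (sync n G)" and c: "consistent n G (s @ [\<sigma>]) u"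
  shows "(joint_state n G s u, Obs (Delta \<sigma>), joint_state n G (s @ [\<sigma>]) u)
    \<in> transitions (sync n (\<lambda>j. two_way_observer (G j)))"
proof -
  have "if Delta \<sigma> \<in> alphabet (two_way_observer (G i))
      then (joint_state n G s u i, Obs (Delta \<sigma>), joint_state n G (s @ [\<sigma>]) u i)
        \<in> transitions (two_way_observer (G i))
      else joint_state n G (s @ [\<sigma>]) u i = joint_state n G s u i" if i: "i \<in> {1..n}" for i
    using observer_state_Delta[OF aut[OF i] proj_in_lists proj_in_lists, of \<sigma> s u]
      bspec[OF c[unfolded consistent_def] i] i
    by (cases "\<sigma> \<in> alphabet (G i)")
      (simp_all add: alphabet_two_way_observer joint_state_def image_iff)
  moreover have "Delta \<sigma> \<in> (\<Union>i\<in>{1..n}. alphabet (two_way_observer (G i)))"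
    using \<sigma> by (auto simp: sync_def alphabet_two_way_observer)
  ultimately show ?thesis
    by (intro sync_ObsI joint_state_in_states aut c consistent_snoc1[OF c])
qed

lemma joint_state_Delta_R:
  assumes aut: "\<And>i. i \<in> {1..n} \<Longrightarrow> automaton (G i)"
    and \<sigma>: "\<sigma> \<in> alphabet (sync n G)" and c: "consistent n G s (u @ [\<sigma>])"
  shows "(joint_state n G s u, Obs (Delta_R \<sigma>), joint_state n G s (u @ [\<sigma>]))
    \<in> transitions (sync n (\<lambda>j. two_way_observer (G j)))"
proof -
  have "if Delta_R \<sigma> \<in> alphabet (two_way_observer (G i))
      then (joint_state n G s u i, Obs (Delta_R \<sigma>), joint_state n G s (u @ [\<sigma>]) i)
        \<in> transitions (two_way_observer (G i))
      else joint_state n G s (u @ [\<sigma>]) i = joint_state n G s u i" if i: "i \<in> {1..n}" for i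
    using observer_state_Delta_R[OF aut[OF i] proj_in_lists proj_in_lists, of \<sigma> s u]
      bspec[OF c[unfolded consistent_def] i] i
    by (cases "\<sigma> \<in> alphabet (G i)")
      (simp_all add: alphabet_two_way_observer joint_state_def image_iff)
  moreover have "Delta_R \<sigma> \<in> (\<Union>i\<in>{1..n}. alphabet (two_way_observer (G i)))"
    using \<sigma> by (auto simp: sync_def alphabet_two_way_observer)
  ultimately show ?thesis
    by (intro sync_ObsI joint_state_in_states aut c consistent_snoc2[OF c])
qed

text \<open>Forward and backward events are distinct, so the composed observer may first read all of
  \<open>s\<close> forwards and then all of \<open>u\<close> backwards. Accordingly the induction on
  \<open>s\<close> is nested in the base case of the induction on \<open>u\<close>.\<close>

lemma joint_state_reachable:
  assumes aut: "\<And>i. i \<in> {1..n} \<Longrightarrow> automaton (G i)"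
    and "s \<in> lists (alphabet (sync n G))" "u \<in> lists (alphabet (sync n G))" "consistent n G s u"
  shows "joint_state n G s u \<in> reachable (sync n (\<lambda>j. two_way_observer (G j)))"
  using assms(3,4)
proof (induction u rule: rev_induct)
  case Nil
  show ?case using assms(2) Nil(2)
  proof (induction s rule: rev_induct)
    case Nil
    have "joint_state n G [] [] \<in> inits (sync n (\<lambda>j. two_way_observer (G j)))"
      unfolding joint_state_def sync_def using observer_state_Nil by auto
    then show ?case unfolding reachable_def by (blast intro: run.simps(1)[THEN iffD2])
  next
    case (snoc \<sigma> s)
    then show ?case
      using reachable_step[OF _ joint_state_Delta[OF aut _ snoc.prems(2)]]
        consistent_snoc1[OF snoc.prems(2)] by simp
  qed
next
  case (snoc \<sigma> u)
  then show ?case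
    using reachable_step[OF _ joint_state_Delta_R[OF aut _ snoc.prems(2)]]
      consistent_snoc2[OF snoc.prems(2)] by simp
qed

section \<open>From the observer condition to opacity\<close>

theorem theorem5:
  fixes n :: nat
    and G :: "nat \<Rightarrow> ('q, 'e) automaton"
    and S :: "nat \<Rightarrow> 'q set"
  assumes "n \<ge> 1"
    and "\<And>i. i \<in> {1..n} \<Longrightarrow> automaton (G i)"
    and "\<And>i. i \<in> {1..n} \<Longrightarrow> S i \<subseteq> states (G i)"
    and "\<And>x i X X_R. x \<in> reachable (sync n (\<lambda>j. two_way_observer (G j))) \<Longrightarrow>
           i \<in> {1..n} \<Longrightarrow> x i = (X, X_R) \<Longrightarrow>
           \<not> (X \<inter> X_R \<subseteq> S i) \<or> X \<inter> X_R = {}"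
  shows "infinite_step_opaque (sync n G) (secret_or n G S)"
  unfolding infinite_step_opaque_def
proof (intro ballI impI)
  fix q0 s t
  assume q0: "q0 \<in> inits (sync n G)"
    and s: "s \<in> lists (alphabet (sync n G))" and t: "t \<in> lists (alphabet (sync n G))"
    and "s @ t \<in> lang (sync n G) q0 \<and> (\<exists>x\<in>secret_or n G S. weak (sync n G) q0 s x)"
  then obtain z where "weak (sync n G) q0 (s @ t) z" unfolding lang_def by blast
  then obtain w where w: "weak (sync n G) q0 s w" and z: "weak (sync n G) w t z"
    unfolding weak_append by blast
  note aut = assms(2)
  define X where "X i = estimate (G i) (proj (G i) s)" for i
  define XR where "XR i = {q. \<exists>p\<in>states (G i). weak (G i) q (proj (G i) t) p}" for i
  have XR: "estimate (reversed (G i)) (proj (G i) (rev t)) = XR i" for i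
    unfolding XR_def by (simp add: estimate_reversed flip: rev_filter)
  \<comment> \<open>The state \<open>w\<close> between \<open>s\<close> and \<open>t\<close> shows
    that no intersection is empty. This gives consistency and later excludes the second alternative
    of the hypothesis.\<close>
  have wX: "w i \<in> X i \<inter> XR i" if i: "i \<in> {1..n}" for i
  proof -
    have q0i: "q0 i \<in> inits (G i)" using q0 i unfolding sync_def by auto
    note wi = weak_sync_component[of i n G, OF i w] and zi = weak_sync_component[of i n G, OF i z]
    have "q0 i \<in> states (G i)" using q0i aut[OF i] unfolding automaton_def by auto
    then have "z i \<in> states (G i)" using weak_in_states[OF aut[OF i]] wi zi by blast
    then show ?thesis using q0i wi zi unfolding X_def XR_def estimate_def by blast
  qed
  have "consistent n G s (rev t)"
    unfolding consistent_def XR using wX unfolding X_def by blast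
  then have reach: "joint_state n G s (rev t) \<in> reachable (sync n (\<lambda>j. two_way_observer (G j)))"
    using joint_state_reachable[OF aut s, of "rev t"] t by (simp add: in_lists_conv_set)
  have "\<exists>y. y \<in> X i \<inter> XR i \<and> y \<notin> S i" if i: "i \<in> {1..n}" for i
  proof -
    have "joint_state n G s (rev t) i = (X i, XR i)"
      using i XR[of i] unfolding joint_state_def observer_state_def X_def by simp
    then show ?thesis using assms(4)[OF reach i] wX[OF i] by blast
  qed
  \<comment> \<open>The nonsecret state \<open>y\<close> may come from another initial state than
    \<open>q0 i\<close> and lead to another end than \<open>z i\<close>. These local choices are
    made separately for each \<open>i\<close>, since \<open>weak_sync\<close> only asks for local
    runs over the projections.\<close>
  then have "\<exists>y p r. p \<in> inits (G i) \<and> weak (G i) p (proj (G i) s) y \<and> r \<in> states (G i) \<and>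
      weak (G i) y (proj (G i) t) r \<and> y \<notin> S i" if "i \<in> {1..n}" for i
    using that unfolding X_def XR_def estimate_def by blast
  then obtain y p r where ypr: "\<And>i. i \<in> {1..n} \<Longrightarrow> p i \<in> inits (G i) \<and>
      weak (G i) (p i) (proj (G i) s) (y i) \<and> r i \<in> states (G i) \<and>
      weak (G i) (y i) (proj (G i) t) (r i) \<and> y i \<notin> S i"
    by metis
  let ?y = "restrict y {1..n}" and ?p = "restrict p {1..n}" and ?r = "restrict r {1..n}"
  have pst: "p i \<in> states (G i)" if i: "i \<in> {1..n}" for i
    using ypr[OF i] aut[OF i] unfolding automaton_def by auto
  have yst: "y i \<in> states (G i)" if i: "i \<in> {1..n}" for i
    using weak_in_states[OF aut[OF i]] ypr[OF i] pst[OF i] by blast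
  have st: "?p \<in> states (sync n G)" "?y \<in> states (sync n G)" "?r \<in> states (sync n G)"
    using pst yst ypr unfolding sync_def by auto
  have "?p \<in> inits (sync n G)" using ypr unfolding sync_def by auto
  \<comment> \<open>Every component of \<open>?y\<close> is nonsecret, which is what being nonsecret
    means under \<open>secret_or\<close>.\<close>
  moreover have "?y \<in> states (sync n G) - secret_or n G S"
    using st(2) yst ypr unfolding secret_or_def by auto
  moreover have "weak (sync n G) ?p s ?y"
    using weak_sync[OF aut s st(1,2)] ypr by simp
  moreover have "weak (sync n G) ?y t ?r"
    using weak_sync[OF aut t st(2,3)] ypr by simp
  ultimately show "\<exists>q0'\<in>inits (sync n G). \<exists>y\<in>states (sync n G) - secret_or n G S.
      weak (sync n G) q0' s y \<and> (\<exists>z. weak (sync n G) y t z)"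
    by blast
qed

end
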